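(* For all integers $s$ and $j$: for every non-negative integer $n$, \[ 2\sum_{k = 0}^n \binom{2n}{2k}F_{j(4k + s)} = \left( L_j^{2n} + 5^n F_j^{2n} \right)F_{j(2n + s)},\qquad 2\sum_{k = 0}^n \binom{2n}{2k}L_{j(4k + s)} = \left( L_j^{2n} + 5^n F_j^{2n} \right)L_{j(2n + s)}, \] and for every positive integer $n$, \[ 2\sum_{k = 0}^{n - 1} \binom{2n-1}{2k}F_{j(4k + s)}= ( - 1)^j\big(L_j^{2n - 1} F_{j(2n + s - 1)} - 5^{n - 1} F_j^{2n - 1} L_{j(2n + s - 1)}\big), \] \[ 2\sum_{k = 0}^{n - 1} \binom{2n-1}{2k} L_{j(4k + s)} =( - 1)^j\big( L_j^{2n - 1} L_{j(2n + s - 1)} - 5^n F_j^{2n - 1} F_{j(2n + s - 1)}\big ). \]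
   Context: The Fibonacci numbers $F_j$ and Lucas numbers $L_j$ are defined for all integers $j$ by $F_0=0$, $F_1=1$, $L_0=2$, $L_1=1$, $F_j=F_{j-1}+F_{j-2}$, $L_j=L_{j-1}+L_{j-2}$, with $F_{-j}=(-1)^{j-1}F_j$ and $L_{-j}=(-1)^jL_j$. Here $0^0=1$. *)

theory Defs
  imports Complex_Main "HOL-Number_Theory.Fib"
begin

fun lucas :: "nat \<Rightarrow> nat" where
  "lucas 0 = 2"
| "lucas (Suc 0) = 1"
| "lucas (Suc (Suc n)) = lucas (Suc n) + lucas n"

definition fib_int :: "int \<Rightarrow> int" where
  "fib_int j = (if 0 \<le> j then int (fib (nat j))
                else (- 1) ^ (nat (- j) - 1) * int (fib (nat (- j))))"

definition lucas_int :: "int \<Rightarrow> int" where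
  "lucas_int j = (if 0 \<le> j then int (lucas (nat j))
                  else (- 1) ^ nat (- j) * int (lucas (nat (- j))))"

text \<open>
  The sign $(-1)^j$ for an integer exponent is rendered over the integers as
  \<open>(- 1) ^ nat \<bar>j\<bar>\<close>; the next lemma relates it to the integer power of a field.
\<close>

lemma minus_one_power_nat_abs:
  "of_int ((- 1) ^ nat \<bar>j\<bar>) = (- 1 :: real) powi j"
  by (auto simp: power_int_def)

lemma fib_int_base [simp]: "fib_int 0 = 0" "fib_int 1 = 1"
  by (simp_all add: fib_int_def)

lemma lucas_int_base [simp]: "lucas_int 0 = 2" "lucas_int 1 = 1"
  by (simp_all add: lucas_int_def)

lemma fib_int_of_nat [simp]: "fib_int (int n) = int (fib n)"
  by (simp add: fib_int_def)

lemma lucas_int_of_nat [simp]: "lucas_int (int n) = int (lucas n)"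
  by (simp add: lucas_int_def)

lemma fib_int_neg: "fib_int (- int (Suc n)) = (- 1) ^ n * int (fib (Suc n))"
proof -
  have "nat (- (- int (Suc n))) = Suc n"
    by linarith
  then show ?thesis
    unfolding fib_int_def by (simp del: fib.simps of_nat_Suc)
qed

lemma lucas_int_neg: "lucas_int (- int n) = (- 1) ^ n * int (lucas n)"
  by (cases n) (simp_all add: lucas_int_def del: of_nat_Suc)

lemma fib_int_rec: "fib_int j = fib_int (j - 1) + fib_int (j - 2)"
proof -
  consider (ge) n where "j = int (Suc (Suc n))" | (one) "j = 1" | (zero) "j = 0"
    | (neg) n where "j = - int (Suc n)"
  proof -
    have "j = int (Suc (Suc (nat (j - 2)))) \<or> j = 1 \<or> j = 0 \<or> j = - int (Suc (nat (- j - 1)))"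
      by linarith
    then show ?thesis
      using that by blast
  qed
  then show ?thesis
  proof cases
    case ge
    then have "j - 1 = int (Suc n)" "j - 2 = int n"
      by simp_all
    then show ?thesis
      using ge by (simp only: fib_int_of_nat) simp
  next
    case one
    then show ?thesis
      using fib_int_neg[of 0] by simp
  next
    case zero
    then show ?thesis
      using fib_int_neg[of 0] fib_int_neg[of 1] by simp
  next
    case neg
    then have "j - 1 = - int (Suc (Suc n))" "j - 2 = - int (Suc (Suc (Suc n)))"
      by simp_all
    then show ?thesis
      using neg by (simp only: fib_int_neg) (simp add: algebra_simps)
  qed
qed

lemma lucas_int_rec: "lucas_int j = lucas_int (j - 1) + lucas_int (j - 2)"
proof -
  consider (ge) n where "j = int (Suc (Suc n))" | (one) "j = 1"
    | (neg) n where "j = - int n"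
  proof -
    have "j = int (Suc (Suc (nat (j - 2)))) \<or> j = 1 \<or> j = - int (nat (- j))"
      by linarith
    then show ?thesis
      using that by blast
  qed
  then show ?thesis
  proof cases
    case ge
    then have "j - 1 = int (Suc n)" "j - 2 = int n"
      by simp_all
    then show ?thesis
      using ge by (simp only: lucas_int_of_nat) simp
  next
    case one
    then show ?thesis
      using lucas_int_neg[of 1] by simp
  next
    case neg
    then have "j - 1 = - int (Suc n)" "j - 2 = - int (Suc (Suc n))"
      by simp_all
    then show ?thesis
      using neg by (simp only: lucas_int_neg) (simp add: algebra_simps)
  qed
qed

end

theory Submission imports Defs begin

text \<open>
  Let \<open>a\<close>, \<open>b\<close> be the roots of \<open>t\<^sup>2 = t + 1\<close> and put \<open>x = a\<^sup>j\<close>, \<open>y = b\<^sup>j\<close>, so that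
  \<open>x y = \<sigma> = (-1)\<^sup>j\<close>, \<open>L\<^sub>j = x + y\<close> and \<open>\<surd>5 F\<^sub>j = x - y\<close>. Since \<open>\<sigma> + x\<^sup>2 = x (x + y)\<close> and
  \<open>\<sigma> - x\<^sup>2 = - x (x - y)\<close>, the even part of the binomial expansion of \<open>(1 + x\<^sup>2)\<^sup>m\<close>
  equals \<open>\<sigma>\<^sup>m x\<^sup>m ((x + y)\<^sup>m + (-(x - y))\<^sup>m) / 2\<close>. Combining this with the
  same identity for \<open>x\<close> and \<open>y\<close> exchanged through Binet's formulas gives all four sums.
\<close>

section \<open>Even-indexed binomial sums\<close>

lemma sum_even_binomial:
  fixes y :: "'a :: comm_ring_1"
  shows "2 * (\<Sum>k=0..m div 2. of_nat (m choose (2 * k)) * y ^ (2 * k)) = (1 + y) ^ m + (1 - y) ^ m"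
proof -
  let ?g = "\<lambda>i. of_nat (m choose i) * y ^ i + of_nat (m choose i) * (- y) ^ i"
  have "(1 + y) ^ m + (1 - y) ^ m = (\<Sum>i\<le>m. ?g i)"
    using binomial_ring[of y 1 m] binomial_ring[of "- y" 1 m]
    by (simp add: sum.distrib add.commute)
  \<comment> \<open>For odd \<open>i\<close> the two halves of \<open>?g i\<close> cancel; for even
    \<open>i\<close> they agree, which produces the factor 2.\<close>
  also have "\<dots> = (\<Sum>i\<in>{i. i \<le> m \<and> even i}. ?g i)"
    by (rule sum.mono_neutral_right) auto
  also have "\<dots> = (\<Sum>k=0..m div 2. ?g (2 * k))"
    by (rule sum.reindex_bij_witness[of _ "\<lambda>k. 2 * k" "\<lambda>i. i div 2"]) auto
  also have "\<dots> = 2 * (\<Sum>k=0..m div 2. of_nat (m choose (2 * k)) * y ^ (2 * k))"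
    by (simp add: sum_distrib_left flip: mult_2)
  finally show ?thesis
    by simp
qed

text \<open>Since \<sigma> * x * y = 1, the products \<sigma> * x * (x + y) and \<sigma> * x * (y -
  x) equal 1 + \<sigma> * x^2 and 1 - \<sigma> * x^2. For either sign these are the two bases 1 +
  x^2 and 1 - x^2, at most in swapped order, and the sum of their \<open>m\<close>-th powers ignores
  the order.\<close>

lemma sum_even_binomial_unit_product:
  fixes x y \<sigma> :: "'a :: idom"
  assumes "x * y = \<sigma>" and "\<sigma>\<^sup>2 = 1"
  shows "2 * (\<Sum>k=0..m div 2. of_nat (m choose (2 * k)) * x ^ (4 * k))
         = \<sigma> ^ m * x ^ m * ((x + y) ^ m + (y - x) ^ m)"
proof -
  have \<sigma>: "\<sigma> = 1 \<or> \<sigma> = - 1"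
    using assms(2) by (simp add: power2_eq_1_iff)
  have "2 * (\<Sum>k=0..m div 2. of_nat (m choose (2 * k)) * x ^ (4 * k))
        = (1 + x\<^sup>2) ^ m + (1 - x\<^sup>2) ^ m"
    using sum_even_binomial[of m "x\<^sup>2"] by (simp flip: power_mult)
  also have "\<dots> = (\<sigma> * x * (x + y)) ^ m + (\<sigma> * x * (y - x)) ^ m"
    using \<sigma>
  proof
    assume "\<sigma> = 1"
    then have "\<sigma> * x * (x + y) = 1 + x\<^sup>2" "\<sigma> * x * (y - x) = 1 - x\<^sup>2"
      using assms(1) by (simp_all add: algebra_simps power2_eq_square)
    then show ?thesis
      by simp
  next
    assume "\<sigma> = - 1"
    then have "\<sigma> * x * (x + y) = 1 - x\<^sup>2" "\<sigma> * x * (y - x) = 1 + x\<^sup>2"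
      using assms(1) by (simp_all add: algebra_simps power2_eq_square)
    then show ?thesis
      by simp
  qed
  finally show ?thesis
    unfolding power_mult_distrib by (simp only: distrib_left)
qed

section \<open>Two-sided Fibonacci recurrences and Binet's formulas\<close>

lemma fibonacci_type_eqI:
  fixes f g :: "int \<Rightarrow> 'a :: ab_group_add"
  assumes f: "\<And>i. f i = f (i - 1) + f (i - 2)" and g: "\<And>i. g i = g (i - 1) + g (i - 2)"
    and "f 0 = g 0" and "f 1 = g 1"
  shows "f j = g j"
proof -
  \<comment> \<open>Agreement on a consecutive pair is what propagates both ways: upwards by the
    recurrence at \<open>i + 2\<close>, downwards by solving the recurrence at \<open>i + 1\<close>
    for the value at \<open>i - 1\<close>.\<close>
  have "f j = g j \<and> f (j + 1) = g (j + 1)"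
  proof (induction j rule: int_induct[where k = 0])
    case base
    then show ?case
      using assms(3,4) by simp
  next
    case (step1 i)
    then show ?case
      using f[of "i + 2"] g[of "i + 2"] by (simp add: algebra_simps)
  next
    case (step2 i)
    then show ?case
      using f[of "i + 1"] g[of "i + 1"] by (simp add: algebra_simps)
  qed
  then show ?thesis ..
qed

definition golden :: real where
  "golden = (1 + sqrt 5) / 2"

definition golden_conj :: real where
  "golden_conj = (1 - sqrt 5) / 2"

lemma golden_mult_conj: "golden * golden_conj = - 1"
  by (simp add: golden_def golden_conj_def field_simps)

lemma golden_nonzero [simp]: "golden \<noteq> 0" "golden_conj \<noteq> 0"
  using golden_mult_conj by auto

lemma golden_squared: "golden\<^sup>2 = golden + 1" "golden_conj\<^sup>2 = golden_conj + 1"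
  by (simp_all add: golden_def golden_conj_def power2_eq_square field_simps)

lemma power_int_fibonacci_rec:
  fixes x :: "'a :: field"
  assumes "x \<noteq> 0" and "x\<^sup>2 = x + 1"
  shows "x powi i = x powi (i - 1) + x powi (i - 2)"
proof -
  have "x powi i = x powi (i - 2) * x\<^sup>2" "x powi (i - 1) = x powi (i - 2) * x"
    using power_int_add[of x "i - 2" 2] power_int_add[of x "i - 2" 1] assms(1) by simp_all
  then show ?thesis
    using assms(2) by (simp add: algebra_simps)
qed

lemmas golden_powi_rec =
  power_int_fibonacci_rec[OF golden_nonzero(1) golden_squared(1)]
  power_int_fibonacci_rec[OF golden_nonzero(2) golden_squared(2)]

text \<open>Both sides satisfy the recurrence on all integers, so comparing them at 0 and 1 suffices
  and negative indices need no sign analysis.\<close>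

lemma binet_fib: "sqrt 5 * real_of_int (fib_int j) = golden powi j - golden_conj powi j"
proof (rule fibonacci_type_eqI[where j = j])
  show "sqrt 5 * real_of_int (fib_int i)
        = sqrt 5 * real_of_int (fib_int (i - 1)) + sqrt 5 * real_of_int (fib_int (i - 2))" for i
    by (subst fib_int_rec) (simp add: algebra_simps)
  show "golden powi i - golden_conj powi i
        = golden powi (i - 1) - golden_conj powi (i - 1)
          + (golden powi (i - 2) - golden_conj powi (i - 2))" for i
    using golden_powi_rec[of i] by simp
qed (simp_all add: golden_def golden_conj_def field_simps)

lemma binet_lucas: "real_of_int (lucas_int j) = golden powi j + golden_conj powi j"
proof (rule fibonacci_type_eqI[where j = j])
  show "real_of_int (lucas_int i)
        = real_of_int (lucas_int (i - 1)) + real_of_int (lucas_int (i - 2))" for i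
    by (subst lucas_int_rec) simp
  show "golden powi i + golden_conj powi i
        = golden powi (i - 1) + golden_conj powi (i - 1)
          + (golden powi (i - 2) + golden_conj powi (i - 2))" for i
    using golden_powi_rec[of i] by simp
qed (simp_all add: golden_def golden_conj_def field_simps)

section \<open>The sums at a general upper index\<close>

lemma sum_even_binomial_powi:
  fixes x y :: "'a :: field"
  assumes "x \<noteq> 0" and "x * y = - 1"
  shows "2 * (\<Sum>k=0..m div 2. of_nat (m choose (2 * k)) * x powi (j * (4 * int k + s)))
         = ((- 1) powi j) ^ m * x powi (j * (int m + s))
           * ((x powi j + y powi j) ^ m + (y powi j - x powi j) ^ m)"
proof -
  have "x powi j * y powi j = (- 1) powi j"
    using assms(2) by (simp flip: power_int_mult_distrib)
  moreover have "((- 1 :: 'a) powi j)\<^sup>2 = 1"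
    by (cases "even j") (simp_all add: power_int_minus_left)
  ultimately have *: "2 * (\<Sum>k=0..m div 2. of_nat (m choose (2 * k)) * (x powi j) ^ (4 * k))
      = ((- 1) powi j) ^ m * (x powi j) ^ m * ((x powi j + y powi j) ^ m + (y powi j - x powi j) ^ m)"
    by (rule sum_even_binomial_unit_product)
  \<comment> \<open>The offset \<open>s\<close> only contributes the factor
    \<open>x powi (j * s)\<close>, which is common to all summands and also appears on the
    right-hand side.\<close>
  have shift: "x powi (j * (int i + s)) = (x powi j) ^ i * x powi (j * s)" for i
    using assms(1) by (simp add: distrib_left power_int_add power_int_mult)
  have "x powi (j * (4 * int k + s)) = (x powi j) ^ (4 * k) * x powi (j * s)" for k
    using shift[of "4 * k"] by simp
  then have "2 * (\<Sum>k=0..m div 2. of_nat (m choose (2 * k)) * x powi (j * (4 * int k + s)))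
        = 2 * (\<Sum>k=0..m div 2. of_nat (m choose (2 * k)) * (x powi j) ^ (4 * k)) * x powi (j * s)"
    by (simp add: sum_distrib_right sum_distrib_left mult_ac)
  then show ?thesis
    unfolding * shift[of m] by (simp only: mult_ac)
qed

text \<open>By Binet, \<open>D\<close> is the difference of the \<open>j\<close>-th powers of the
  two roots. Exchanging the roots fixes \<open>L\<close> and negates \<open>D\<close>, hence
  \<open>- D\<close> in one formula and \<open>D\<close> in the other.\<close>

lemma sum_even_binomial_golden:
  fixes j s :: int
  defines "\<sigma> \<equiv> (- 1 :: real) powi j" and "L \<equiv> real_of_int (lucas_int j)"
    and "D \<equiv> sqrt 5 * real_of_int (fib_int j)"
  shows "2 * (\<Sum>k=0..m div 2. real (m choose (2 * k)) * golden powi (j * (4 * int k + s)))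
         = \<sigma> ^ m * golden powi (j * (int m + s)) * (L ^ m + (- D) ^ m)"
    and "2 * (\<Sum>k=0..m div 2. real (m choose (2 * k)) * golden_conj powi (j * (4 * int k + s)))
         = \<sigma> ^ m * golden_conj powi (j * (int m + s)) * (L ^ m + D ^ m)"
  using sum_even_binomial_powi[of golden golden_conj m j s]
    sum_even_binomial_powi[of golden_conj golden m j s] golden_mult_conj
  by (simp_all add: assms binet_fib binet_lucas mult.commute[of golden_conj] add.commute)

text \<open>The difference and the sum of the two root formulas. The parity of \<open>m\<close>
  stays open here; it decides below how \<open>(- D) ^ m\<close> simplifies.\<close>

lemma sum_even_binomial_fib_lucas:
  fixes j s :: int
  defines "\<sigma> \<equiv> (- 1 :: real) powi j" and "L \<equiv> real_of_int (lucas_int j)"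
    and "D \<equiv> sqrt 5 * real_of_int (fib_int j)"
  shows "sqrt 5 * (2 * (\<Sum>k=0..m div 2. real (m choose (2 * k)) * fib_int (j * (4 * int k + s))))
         = \<sigma> ^ m * (golden powi (j * (int m + s)) * (L ^ m + (- D) ^ m)
                       - golden_conj powi (j * (int m + s)) * (L ^ m + D ^ m))"
    and "2 * (\<Sum>k=0..m div 2. real (m choose (2 * k)) * lucas_int (j * (4 * int k + s)))
         = \<sigma> ^ m * (golden powi (j * (int m + s)) * (L ^ m + (- D) ^ m)
                       + golden_conj powi (j * (int m + s)) * (L ^ m + D ^ m))"
proof -
  note G = sum_even_binomial_golden[of m j s, folded \<sigma>_def L_def D_def]
  have "sqrt 5 * (2 * (\<Sum>k=0..m div 2. real (m choose (2 * k)) * fib_int (j * (4 * int k + s))))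
      = 2 * (\<Sum>k=0..m div 2. real (m choose (2 * k)) * (sqrt 5 * fib_int (j * (4 * int k + s))))"
    by (simp add: sum_distrib_left mult_ac)
  also have "\<dots> = 2 * (\<Sum>k=0..m div 2. real (m choose (2 * k)) * golden powi (j * (4 * int k + s)))
      - 2 * (\<Sum>k=0..m div 2. real (m choose (2 * k)) * golden_conj powi (j * (4 * int k + s)))"
    unfolding binet_fib by (simp add: right_diff_distrib sum_subtractf)
  finally show "sqrt 5 * (2 * (\<Sum>k=0..m div 2. real (m choose (2 * k)) * fib_int (j * (4 * int k + s))))
      = \<sigma> ^ m * (golden powi (j * (int m + s)) * (L ^ m + (- D) ^ m)
                       - golden_conj powi (j * (int m + s)) * (L ^ m + D ^ m))"
    unfolding G by (simp add: algebra_simps)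
  have "2 * (\<Sum>k=0..m div 2. real (m choose (2 * k)) * lucas_int (j * (4 * int k + s)))
      = 2 * (\<Sum>k=0..m div 2. real (m choose (2 * k)) * golden powi (j * (4 * int k + s)))
      + 2 * (\<Sum>k=0..m div 2. real (m choose (2 * k)) * golden_conj powi (j * (4 * int k + s)))"
    unfolding binet_lucas by (simp add: distrib_left sum.distrib)
  then show "2 * (\<Sum>k=0..m div 2. real (m choose (2 * k)) * lucas_int (j * (4 * int k + s)))
      = \<sigma> ^ m * (golden powi (j * (int m + s)) * (L ^ m + (- D) ^ m)
                       + golden_conj powi (j * (int m + s)) * (L ^ m + D ^ m))"
    unfolding G by (simp add: algebra_simps)
qed

section \<open>Splitting by the parity of the upper index\<close>

lemma minus_one_powi_even_power:
  "((- 1 :: 'a :: field) powi j) ^ (2 * n) = 1"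
  by (cases "even j") (simp_all add: power_int_minus_left)

text \<open>For an even exponent the signs of \<sigma> and \<open>- D\<close> disappear, so both
  roots carry the same factor L^(2n) + D^(2n), which is \<open>C\<close>; Binet then applies to what
  remains.\<close>

lemma sum_even_binomial_even:
  fixes j s :: int and n :: nat
  defines "C \<equiv> lucas_int j ^ (2 * n) + 5 ^ n * fib_int j ^ (2 * n)"
  shows "2 * (\<Sum>k=0..n. int ((2 * n) choose (2 * k)) * fib_int (j * (4 * int k + s)))
         = C * fib_int (j * (2 * int n + s))" (is "?F = ?F'")
    and "2 * (\<Sum>k=0..n. int ((2 * n) choose (2 * k)) * lucas_int (j * (4 * int k + s)))
         = C * lucas_int (j * (2 * int n + s))" (is "?L = ?L'")
proof -
  have D: "(sqrt 5 * real_of_int (fib_int j)) ^ (2 * n) = 5 ^ n * real_of_int (fib_int j) ^ (2 * n)"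
    by (simp add: power_mult_distrib power_mult)
  have C: "real_of_int C = real_of_int (lucas_int j) ^ (2 * n)
      + (sqrt 5 * real_of_int (fib_int j)) ^ (2 * n)"
    unfolding C_def D by simp
  note S = sum_even_binomial_fib_lucas[of "2 * n" j s, unfolded minus_one_powi_even_power]
  have "sqrt 5 * real_of_int ?F = real_of_int C * (sqrt 5 * real_of_int (fib_int (j * (2 * int n + s))))"
    using S(1) unfolding C binet_fib[of "j * (2 * int n + s)"]
    by (simp add: left_diff_distrib right_diff_distrib mult.commute)
  then have "sqrt 5 * real_of_int ?F = sqrt 5 * real_of_int ?F'"
    by (simp only: of_int_mult mult_ac)
  \<comment> \<open>Cancelling the nonzero \<open>sqrt 5\<close> brings the real equation back to
    the integers.\<close>
  then show "?F = ?F'"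
    by (simp only: mult_cancel_left of_int_eq_iff) simp
  have "real_of_int ?L = real_of_int C * real_of_int (lucas_int (j * (2 * int n + s)))"
    using S(2) unfolding C binet_lucas[of "j * (2 * int n + s)"]
    by (simp add: distrib_left distrib_right mult.commute)
  then show "?L = ?L'"
    by (simp only: of_int_eq_iff flip: of_int_mult)
qed

text \<open>For odd \<open>m\<close> the term \<open>D ^ m\<close> enters with opposite signs for
  the two roots. A difference of root powers thus becomes a sum next to \<open>D ^ m\<close> and
  conversely, which is why Fibonacci and Lucas numbers trade places in the second term.\<close>

lemma sum_even_binomial_odd:
  fixes j s :: int and n :: nat
  defines "m \<equiv> 2 * n + 1"
  shows "2 * (\<Sum>k=0..n. int (m choose (2 * k)) * fib_int (j * (4 * int k + s)))
         = (- 1) ^ nat \<bar>j\<bar> * (lucas_int j ^ m * fib_int (j * (int m + s))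
             - 5 ^ n * fib_int j ^ m * lucas_int (j * (int m + s)))" (is "?F = ?F'")
    and "2 * (\<Sum>k=0..n. int (m choose (2 * k)) * lucas_int (j * (4 * int k + s)))
         = (- 1) ^ nat \<bar>j\<bar> * (lucas_int j ^ m * lucas_int (j * (int m + s))
             - 5 ^ (n + 1) * fib_int j ^ m * fib_int (j * (int m + s)))" (is "?L = ?L'")
proof -
  let ?\<sigma> = "(- 1 :: real) powi j" and ?x = "golden powi (j * (int m + s))"
    and ?y = "golden_conj powi (j * (int m + s))"
    and ?l = "real_of_int (lucas_int j)" and ?f = "real_of_int (fib_int j)"
  have m: "m div 2 = n" "odd m"
    by (simp_all add: m_def)
  have D: "(sqrt 5 * ?f) ^ m = sqrt 5 * 5 ^ n * ?f ^ m"
    by (simp add: m_def power_mult_distrib power_mult)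
  have \<sigma>: "?\<sigma> ^ m = ?\<sigma>"
    unfolding m_def power_add minus_one_powi_even_power by simp
  note S = sum_even_binomial_fib_lucas[of m j s, unfolded \<sigma> m(1) power_minus_odd[OF m(2)]]
  have "sqrt 5 * real_of_int ?F = ?\<sigma> * (?l ^ m * (?x - ?y) - (sqrt 5 * ?f) ^ m * (?x + ?y))"
    using S(1) by (simp add: algebra_simps)
  \<comment> \<open>The odd power \<open>D ^ m\<close> leaves one spare \<open>sqrt 5\<close>. Here
    it cancels against the left-hand side; in the Lucas case it meets the \<open>sqrt 5\<close> from
    Binet and raises \<open>5 ^ n\<close> to \<open>5 ^ (n + 1)\<close>.\<close>
  also have "\<dots> = sqrt 5 * real_of_int ?F'"
    unfolding D binet_fib[symmetric] binet_lucas[symmetric] of_int_mult minus_one_power_nat_abs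
    by (simp add: algebra_simps)
  finally show "?F = ?F'"
    by (simp only: mult_cancel_left of_int_eq_iff) simp
  have "real_of_int ?L = ?\<sigma> * (?l ^ m * (?x + ?y) - (sqrt 5 * ?f) ^ m * (?x - ?y))"
    using S(2) by (simp add: algebra_simps)
  also have "\<dots> = real_of_int ?L'"
    unfolding D binet_fib[symmetric] binet_lucas[symmetric] of_int_mult minus_one_power_nat_abs
    by (simp add: algebra_simps)
  finally show "?L = ?L'"
    by (simp only: of_int_eq_iff)
qed

theorem theorem1:
  fixes s j :: int
  shows "(\<forall>n::nat.
            2 * (\<Sum>k=0..n. int ((2 * n) choose (2 * k)) * fib_int (j * (4 * int k + s)))
              = (lucas_int j ^ (2 * n) + 5 ^ n * fib_int j ^ (2 * n)) * fib_int (j * (2 * int n + s))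
          \<and> 2 * (\<Sum>k=0..n. int ((2 * n) choose (2 * k)) * lucas_int (j * (4 * int k + s)))
              = (lucas_int j ^ (2 * n) + 5 ^ n * fib_int j ^ (2 * n)) * lucas_int (j * (2 * int n + s)))
       \<and> (\<forall>n::nat. n > 0 \<longrightarrow>
            2 * (\<Sum>k=0..n - 1. int ((2 * n - 1) choose (2 * k)) * fib_int (j * (4 * int k + s)))
              = (- 1) ^ nat \<bar>j\<bar> *
                (lucas_int j ^ (2 * n - 1) * fib_int (j * (2 * int n + s - 1))
                 - 5 ^ (n - 1) * fib_int j ^ (2 * n - 1) * lucas_int (j * (2 * int n + s - 1)))
          \<and> 2 * (\<Sum>k=0..n - 1. int ((2 * n - 1) choose (2 * k)) * lucas_int (j * (4 * int k + s)))
              = (- 1) ^ nat \<bar>j\<bar> *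
                (lucas_int j ^ (2 * n - 1) * lucas_int (j * (2 * int n + s - 1))
                 - 5 ^ n * fib_int j ^ (2 * n - 1) * fib_int (j * (2 * int n + s - 1))))"
proof (intro conjI allI impI, goal_cases)
  case (1 n)
  show ?case
    by (rule sum_even_binomial_even)
next
  case (2 n)
  show ?case
    by (rule sum_even_binomial_even)
next
  case (3 n)
  \<comment> \<open>With \<open>n = Suc p\<close> the upper index \<open>2 * n - 1\<close> is
    \<open>2 * p + 1\<close>, free of truncated subtraction.\<close>
  then obtain p where "n = Suc p"
    using gr0_conv_Suc by blast
  then show ?case
    using sum_even_binomial_odd(1)[where n = p and j = j and s = s] by (simp add: algebra_simps)
next
  case (4 n)
  then obtain p where "n = Suc p"
    using gr0_conv_Suc by blast
  then show ?case
    using sum_even_binomial_odd(2)[where n = p and j = j and s = s] by (simp add: algebra_simps)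
qed

end
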